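(* Let $p$ be an odd prime, and let $B_p=(p-1)H_p-D_p$. Then $$\mathcal{E}(G_p)=(p+1)(p-2)+\mathcal{E}(B_p).$$
   Context: For $n\ge2$, $\mathbb{L}_n=\{a+bi+cj+dk: a,b,c,d\in\mathbb{Z}/n\mathbb{Z}\}$ is the ring of Lipschitz quaternions modulo $n$, with the usual relations $i^2=j^2=k^2=-1$, $ij=k=-ji$, $jk=i=-kj$, $ki=j=-ik$ taken modulo $n$. A nonzero element $x$ of a ring is a zero divisor if $xy=0$ or $yx=0$ for some nonzero $y$. $G_n=\Gamma(\mathbb{L}_n)$ is the simple undirected graph whose vertices are the nonzero zero divisors of $\mathbb{L}_n$, distinct $x,y$ being adjacent iff $xy=0$ or $yx=0$. (For odd primes $p$, $\mathbb{L}_p\cong M_2(\mathbb{F}_p)$.) $\mathcal{L}$ is the set of the $p+1$ one-dimensional subspaces of $\mathbb{F}_p^2$, and $\mathcal{T}=\mathcal{L}\times\mathcal{L}$. $H_p$ is the $\mathcal{T}\times\mathcal{T}$ $(0,1)$-matrix whose $((L,M),(L',M'))$ entry is $1$ iff $M=L'$ or $M'=L$; $D_p$ is the diagonal $\mathcal{T}\times\mathcal{T}$ matrix whose $((L,M),(L,M))$ entry is $1$ if $L=M$ and $0$ otherwise. The energy $\mathcal{E}(G)$ of a graph $G$ is the sum of the absolute values of the eigenvalues (with multiplicity) of its adjacency matrix; for a real symmetric matrix $M$, $\mathcal{E}(M)$ is the sum of the absolute values of its eigenvalues (with multiplicity). *)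

theory Defs
  imports
    "HOL-Number_Theory.Residues"
    "Jordan_Normal_Form.Char_Poly"
    "Graph_Theory.Pair_Digraph"
begin

section \<open>Lipschitz quaternions modulo n\<close>

text \<open>The tuple \<open>(a, b, c, d)\<close> stands for \<open>a + bi + cj + dk\<close>.\<close>

definition quaternion_ring :: "('a, 'm) ring_scheme \<Rightarrow> ('a \<times> 'a \<times> 'a \<times> 'a) ring" where
  "quaternion_ring R =
    \<lparr>carrier = carrier R \<times> carrier R \<times> carrier R \<times> carrier R,
     monoid.mult = (\<lambda>(a, b, c, d) (a', b', c', d').
       (a \<otimes>\<^bsub>R\<^esub> a' \<ominus>\<^bsub>R\<^esub> b \<otimes>\<^bsub>R\<^esub> b' \<ominus>\<^bsub>R\<^esub> c \<otimes>\<^bsub>R\<^esub> c' \<ominus>\<^bsub>R\<^esub> d \<otimes>\<^bsub>R\<^esub> d',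
        a \<otimes>\<^bsub>R\<^esub> b' \<oplus>\<^bsub>R\<^esub> b \<otimes>\<^bsub>R\<^esub> a' \<oplus>\<^bsub>R\<^esub> c \<otimes>\<^bsub>R\<^esub> d' \<ominus>\<^bsub>R\<^esub> d \<otimes>\<^bsub>R\<^esub> c',
        a \<otimes>\<^bsub>R\<^esub> c' \<ominus>\<^bsub>R\<^esub> b \<otimes>\<^bsub>R\<^esub> d' \<oplus>\<^bsub>R\<^esub> c \<otimes>\<^bsub>R\<^esub> a' \<oplus>\<^bsub>R\<^esub> d \<otimes>\<^bsub>R\<^esub> b',
        a \<otimes>\<^bsub>R\<^esub> d' \<oplus>\<^bsub>R\<^esub> b \<otimes>\<^bsub>R\<^esub> c' \<ominus>\<^bsub>R\<^esub> c \<otimes>\<^bsub>R\<^esub> b' \<oplus>\<^bsub>R\<^esub> d \<otimes>\<^bsub>R\<^esub> a')),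
     one = (\<one>\<^bsub>R\<^esub>, \<zero>\<^bsub>R\<^esub>, \<zero>\<^bsub>R\<^esub>, \<zero>\<^bsub>R\<^esub>),
     zero = (\<zero>\<^bsub>R\<^esub>, \<zero>\<^bsub>R\<^esub>, \<zero>\<^bsub>R\<^esub>, \<zero>\<^bsub>R\<^esub>),
     add = (\<lambda>(a, b, c, d) (a', b', c', d').
       (a \<oplus>\<^bsub>R\<^esub> a', b \<oplus>\<^bsub>R\<^esub> b', c \<oplus>\<^bsub>R\<^esub> c', d \<oplus>\<^bsub>R\<^esub> d'))\<rparr>"

definition lipschitz :: "nat \<Rightarrow> (int \<times> int \<times> int \<times> int) ring" where
  "lipschitz n = quaternion_ring (residue_ring (int n))"


section \<open>Zero divisor graphs\<close>

definition zero_divisors :: "('a, 'm) ring_scheme \<Rightarrow> 'a set" where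
  "zero_divisors R = {x \<in> carrier R - {\<zero>\<^bsub>R\<^esub>}.
     \<exists>y \<in> carrier R - {\<zero>\<^bsub>R\<^esub>}. x \<otimes>\<^bsub>R\<^esub> y = \<zero>\<^bsub>R\<^esub> \<or> y \<otimes>\<^bsub>R\<^esub> x = \<zero>\<^bsub>R\<^esub>}"

text \<open>A simple undirected graph is a symmetric loop-free pair digraph: the edge between
  \<open>x\<close> and \<open>y\<close> is the pair of arcs \<open>(x, y)\<close>, \<open>(y, x)\<close>.\<close>

definition zero_divisor_graph :: "('a, 'm) ring_scheme \<Rightarrow> 'a pair_pre_digraph" where
  "zero_divisor_graph R =
    \<lparr>pverts = zero_divisors R,
     parcs = {(x, y). x \<in> zero_divisors R \<and> y \<in> zero_divisors R \<and> x \<noteq> y \<and>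
       (x \<otimes>\<^bsub>R\<^esub> y = \<zero>\<^bsub>R\<^esub> \<or> y \<otimes>\<^bsub>R\<^esub> x = \<zero>\<^bsub>R\<^esub>)}\<rparr>"

lemma pair_graph_zero_divisor_graph:
  assumes "finite (carrier R)"
  shows "pair_graph (zero_divisor_graph R)"
proof -
  have fin: "finite (zero_divisors R)"
    using assms by (simp add: zero_divisors_def)
  have "parcs (zero_divisor_graph R) \<subseteq> zero_divisors R \<times> zero_divisors R"
    by (auto simp: zero_divisor_graph_def)
  with fin have "finite (parcs (zero_divisor_graph R))"
    by (meson finite_SigmaI finite_subset)
  then show ?thesis
    using fin
    by unfold_locales
      (auto simp: zero_divisor_graph_def Digraph.symmetric_def with_proj_simps intro!: symI)
qed

definition lipschitz_graph :: "nat \<Rightarrow> (int \<times> int \<times> int \<times> int) pair_pre_digraph" where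
  "lipschitz_graph n = zero_divisor_graph (lipschitz n)"


section \<open>Energy\<close>

text \<open>Matrices whose rows and columns are indexed by a finite set \<open>V\<close> are encoded by fixing an
  arbitrary enumeration of \<open>V\<close>. The choice depends only on \<open>V\<close>, so all matrices over the same
  \<open>V\<close> use the same enumeration and sums and scalar multiples are the intended ones; changing the
  enumeration conjugates the matrix by a permutation matrix.\<close>

definition enumeration :: "'a set \<Rightarrow> 'a list" where
  "enumeration V = (SOME xs. distinct xs \<and> set xs = V)"

lemma enumeration:
  assumes "finite V"
  shows "distinct (enumeration V)" and "set (enumeration V) = V"
    and "length (enumeration V) = card V"
proof -
  have "\<exists>xs. distinct xs \<and> set xs = V"
    using finite_distinct_list[OF assms] by blast
  then have "distinct (enumeration V) \<and> set (enumeration V) = V"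
    unfolding enumeration_def by (rule someI_ex)
  then show "distinct (enumeration V)" "set (enumeration V) = V"
    "length (enumeration V) = card V"
    using distinct_card by fastforce+
qed

definition indexed_mat :: "'a set \<Rightarrow> ('a \<Rightarrow> 'a \<Rightarrow> 'b) \<Rightarrow> 'b mat" where
  "indexed_mat V f =
    mat (card V) (card V) (\<lambda>(i, j). f (enumeration V ! i) (enumeration V ! j))"

text \<open>\<open>proots\<close> counts roots with multiplicity. Only real roots are summed, which for a real
  symmetric matrix are all the eigenvalues.\<close>

definition matrix_energy :: "real mat \<Rightarrow> real" where
  "matrix_energy A = (\<Sum>x\<in>#proots (char_poly A). \<bar>x\<bar>)"

definition adjacency_matrix :: "'a pair_pre_digraph \<Rightarrow> real mat" where
  "adjacency_matrix \<Gamma> = indexed_mat (pverts \<Gamma>) (\<lambda>x y. if (x, y) \<in> parcs \<Gamma> then 1 else 0)"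

definition graph_energy :: "'a pair_pre_digraph \<Rightarrow> real" where
  "graph_energy \<Gamma> = matrix_energy (adjacency_matrix \<Gamma>)"


section \<open>Pairs of lines in the plane over the prime field\<close>

definition one_dim_subspaces :: "('a, 'm) ring_scheme \<Rightarrow> ('a \<times> 'a) set set" where
  "one_dim_subspaces K =
    {{(c \<otimes>\<^bsub>K\<^esub> u, c \<otimes>\<^bsub>K\<^esub> v) | c. c \<in> carrier K} | u v.
      u \<in> carrier K \<and> v \<in> carrier K \<and> (u, v) \<noteq> (\<zero>\<^bsub>K\<^esub>, \<zero>\<^bsub>K\<^esub>)}"

definition lines :: "nat \<Rightarrow> (int \<times> int) set set" where
  "lines p = one_dim_subspaces (residue_ring (int p))"

definition line_pairs :: "nat \<Rightarrow> ((int \<times> int) set \<times> (int \<times> int) set) set" where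
  "line_pairs p = lines p \<times> lines p"

definition H_mat :: "nat \<Rightarrow> real mat" where
  "H_mat p = indexed_mat (line_pairs p) (\<lambda>(L, M) (L', M'). if M = L' \<or> M' = L then 1 else 0)"

definition D_mat :: "nat \<Rightarrow> real mat" where
  "D_mat p = indexed_mat (line_pairs p) (\<lambda>(L, M) (L', M'). if (L, M) = (L', M') \<and> L = M then 1 else 0)"

definition B_mat :: "nat \<Rightarrow> real mat" where
  "B_mat p = (real p - 1) \<cdot>\<^sub>m H_mat p - D_mat p"

end

theory Submission
  imports Defs
begin

text \<open>The ring of quaternions modulo an odd prime \<open>p\<close> is a ring of \<open>2 \<times> 2\<close> matrices over the
  field with \<open>p\<close> elements, and its nonzero zero divisors are the matrices of rank one. Such a matrix
  is determined up to a nonzero scalar by its image \<open>L\<close> and its kernel \<open>M\<close>, and any pair of lines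
  \<open>(L, M)\<close> occurs; so the vertices of the graph fall into \<open>(p + 1)\<^sup>2\<close> classes of \<open>p - 1\<close> elements.
  A product \<open>x y\<close> of two of them vanishes iff the image of \<open>y\<close> is the kernel of \<open>x\<close>. Hence
  adjacency depends on the classes only, except that a matrix of square zero (\<open>L = M\<close>) is not
  adjacent to itself: the adjacency matrix is the blow-up of \<open>H\<close> in which every entry is repeated over
  a block with \<open>p - 1\<close> rows and columns, minus a diagonal matrix that is constant on each class
  with value \<open>[L = M]\<close>.

  On the vectors that are constant on the classes such a matrix acts as \<open>(p - 1) H - D = B\<close>. On a vector
  supported on one class with entries summing to zero the blow-up part vanishes and only the scalar
  \<open>-[L = M]\<close> is left. This gives an eigenvalue \<open>-1\<close> with multiplicity \<open>p - 2\<close> for each of the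
  \<open>p + 1\<close> classes with \<open>L = M\<close>, zeros for the other classes, and the eigenvalues of \<open>B\<close>.

  The spectral half is \<open>matrix_energy_blow_up\<close>, for blow-ups with classes of equal
  size. The algebraic half is carried
  by \<open>zero_divisors_eq\<close>, \<open>mult_eq_0_iff_lines\<close> and \<open>card_fibre\<close>. Elements of the prime field are
  integers, and equality in the field is divisibility of a difference by \<open>p\<close>.\<close>

section \<open>The energy of a blown-up matrix\<close>

text \<open>Rows and columns are named by list entries, so that changing the enumeration of the index set
  and changing the basis become one and the same kind of matrix product.\<close>

definition list_mat :: "'a list \<Rightarrow> 'a list \<Rightarrow> ('a \<Rightarrow> 'a \<Rightarrow> 'b) \<Rightarrow> 'b mat" where
  "list_mat xs ys f = mat (length xs) (length ys) (\<lambda>(i, j). f (xs ! i) (ys ! j))"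

lemma indexed_mat_eq_list_mat:
  assumes "finite V"
  shows "indexed_mat V f = list_mat (enumeration V) (enumeration V) f"
  by (simp add: indexed_mat_def list_mat_def enumeration[OF assms])

lemma list_mat_carrier [simp]: "list_mat xs ys f \<in> carrier_mat (length xs) (length ys)"
  by (simp add: list_mat_def)

lemma list_mat_cong:
  assumes "\<And>x y. x \<in> set xs \<Longrightarrow> y \<in> set ys \<Longrightarrow> f x y = g x y"
  shows "list_mat xs ys f = list_mat xs ys g"
  unfolding list_mat_def by (rule eq_matI) (auto simp: assms)

lemma list_mat_mult:
  fixes f g :: "'a \<Rightarrow> 'a \<Rightarrow> 'b :: semiring_0"
  assumes "distinct ys"
  shows "list_mat xs ys f * list_mat ys zs g =
    list_mat xs zs (\<lambda>x z. \<Sum>y\<in>set ys. f x y * g y z)"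
proof -
  have "bij_betw (\<lambda>i. ys ! i) {0..<length ys} (set ys)"
    using bij_betw_nth[OF assms] by (simp add: atLeast0LessThan)
  then have "(\<Sum>i = 0..<length ys. h (ys ! i)) = sum h (set ys)" for h :: "'a \<Rightarrow> 'b"
    by (rule sum.reindex_bij_betw)
  then show ?thesis
    unfolding list_mat_def by (intro eq_matI) (auto simp: scalar_prod_def)
qed

lemma list_mat_one:
  assumes "distinct xs"
  shows "list_mat xs xs (\<lambda>x y. of_bool (x = y)) = 1\<^sub>m (length xs)"
  unfolding list_mat_def using assms by (intro eq_matI) (auto simp: nth_eq_iff_index_eq)

text \<open>The hypotheses mention index elements and never positions: \<open>P\<close> and \<open>Q\<close> are mutually inverse
  as functions on \<open>V \<times> V\<close>. As \<open>P\<close> is read with rows along \<open>xs\<close> and columns along \<open>ys\<close>, the change of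
  basis also absorbs the reordering from \<open>xs\<close> to \<open>ys\<close>.\<close>

lemma similar_list_mat:
  fixes a t P Q :: "'a \<Rightarrow> 'a \<Rightarrow> 'b :: comm_ring_1"
  assumes xs: "distinct xs" "set xs = V" and ys: "distinct ys" "set ys = V"
    and PQ: "\<And>x z. x \<in> V \<Longrightarrow> z \<in> V \<Longrightarrow> (\<Sum>y\<in>V. P x y * Q y z) = of_bool (x = z)"
    and QP: "\<And>x z. x \<in> V \<Longrightarrow> z \<in> V \<Longrightarrow> (\<Sum>y\<in>V. Q x y * P y z) = of_bool (x = z)"
    and aP: "\<And>x z. x \<in> V \<Longrightarrow> z \<in> V \<Longrightarrow> (\<Sum>y\<in>V. a x y * P y z) = (\<Sum>y\<in>V. P x y * t y z)"
  shows "similar_mat (list_mat xs xs a) (list_mat ys ys t)"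
proof (rule similar_matI)
  let ?A = "list_mat xs xs a" and ?T = "list_mat ys ys t"
  let ?P = "list_mat xs ys P" and ?Q = "list_mat ys xs Q"
  let ?n = "length xs"
  have n: "length ys = ?n"
    using xs ys distinct_card by metis
  then show car: "{?A, ?T, ?P, ?Q} \<subseteq> carrier_mat ?n ?n"
    using list_mat_carrier by (metis empty_subsetI insert_subset)
  show one: "?P * ?Q = 1\<^sub>m ?n"
    unfolding list_mat_mult[OF ys(1)] list_mat_one[OF xs(1), symmetric]
    by (rule list_mat_cong) (simp add: xs ys PQ)
  show "?Q * ?P = 1\<^sub>m ?n"
    unfolding list_mat_mult[OF xs(1)] n[symmetric] list_mat_one[OF ys(1), symmetric]
    by (rule list_mat_cong) (simp add: xs ys QP)
  have "?A * ?P = ?P * ?T"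
    unfolding list_mat_mult[OF xs(1)] list_mat_mult[OF ys(1)]
    by (rule list_mat_cong) (simp add: xs ys aP)
  moreover have "?A = ?A * (?P * ?Q)"
    unfolding one using right_mult_one_mat[OF list_mat_carrier[of xs xs a]] by simp
  moreover have "?A * (?P * ?Q) = ?A * ?P * ?Q"
    by (rule assoc_mult_mat[symmetric]) (rule list_mat_carrier)+
  ultimately show "?A = ?P * ?T * ?Q"
    by simp
qed

lemma char_poly_block_triangular:
  fixes A :: "'a :: idom mat"
  assumes A: "A \<in> carrier_mat n n" and B: "B \<in> carrier_mat n m" and D: "D \<in> carrier_mat m m"
  shows "char_poly (four_block_mat A B (0\<^sub>m m n) D) = char_poly A * char_poly D"
proof -
  let ?B = "map_mat (\<lambda>a. [:- a:]) B"
  have "char_poly_matrix (four_block_mat A B (0\<^sub>m m n) D) =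
      four_block_mat (char_poly_matrix A) ?B (0\<^sub>m m n) (char_poly_matrix D)"
    unfolding char_poly_matrix_def using assms by (intro eq_matI) auto
  then show ?thesis
    unfolding char_poly_def using assms
    by (simp add: det_four_block_mat_lower_left_zero[of _ n _ m])
qed

lemma matrix_energy_similar: "similar_mat A B \<Longrightarrow> matrix_energy A = matrix_energy B"
  by (simp add: matrix_energy_def char_poly_similar)

lemma char_poly_nonzero: "A \<in> carrier_mat n n \<Longrightarrow> char_poly A \<noteq> 0"
  using degree_monic_char_poly[of A n] by (metis coeff_0 zero_neq_one)

lemma matrix_energy_block_triangular:
  assumes A: "A \<in> carrier_mat n n" and B: "B \<in> carrier_mat n m" and D: "D \<in> carrier_mat m m"
  shows "matrix_energy (four_block_mat A B (0\<^sub>m m n) D) = matrix_energy A + matrix_energy D"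
  unfolding matrix_energy_def char_poly_block_triangular[OF assms]
  using assms by (simp add: proots_mult char_poly_nonzero)

lemma matrix_energy_diagonal:
  assumes "distinct xs"
  shows "matrix_energy (list_mat xs xs (\<lambda>x y. if x = y then f x else 0)) = (\<Sum>x\<in>set xs. \<bar>f x\<bar>)"
proof -
  let ?A = "list_mat xs xs (\<lambda>x y. if x = y then f x else 0)"
  have ut: "upper_triangular ?A"
    using assms by (auto simp: list_mat_def upper_triangular_def nth_eq_iff_index_eq)
  have "diag_mat ?A = map f xs"
    by (rule nth_equalityI) (auto simp: diag_mat_def list_mat_def)
  then have "char_poly ?A = (\<Prod>a\<leftarrow>map f xs. [:- a, 1:])"
    using char_poly_upper_triangular[OF list_mat_carrier ut] by simp
  also have "\<dots> = (\<Prod>x\<leftarrow>xs. [:- f x, 1:])"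
    by (simp add: o_def)
  finally have "char_poly ?A = (\<Prod>x\<in>set xs. [:- f x, 1:])"
    using assms by (simp add: prod.distinct_set_conv_list)
  then have "proots (char_poly ?A) = (\<Sum>x\<in>set xs. {#f x#})"
    by (simp add: proots_prod)
  moreover have "(\<Sum>a\<in>#(\<Sum>x\<in>S. {#f x#}). \<bar>a\<bar>) = (\<Sum>x\<in>S. \<bar>f x\<bar>)" if "finite S" for S
    using that by induction auto
  ultimately show ?thesis
    by (simp add: matrix_energy_def)
qed

text \<open>The action of an elementary matrix, read off in row \<open>x\<close>.\<close>

lemma sum_add_of_bool_mult:
  fixes g :: "'a \<Rightarrow> 'b :: comm_ring_1"
  assumes "finite V" "x \<in> V" "q \<Longrightarrow> z \<in> V"
  shows "(\<Sum>y\<in>V. (of_bool (x = y) + c * of_bool (q \<and> y = z)) * g y) = g x + (if q then c * g z else 0)"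
proof -
  have "(\<Sum>y\<in>V. (of_bool (x = y) + c * of_bool (q \<and> y = z)) * g y) =
      (\<Sum>y\<in>V. if y = x then g y else 0) + (\<Sum>y\<in>V. if y = z then (if q then c * g y else 0) else 0)"
    unfolding sum.distrib[symmetric] by (rule sum.cong) (auto simp: algebra_simps)
  also have "\<dots> = g x + (if q then c * g z else 0)"
    using assms by (auto simp: sum.delta)
  finally show ?thesis .
qed

text \<open>Choose a representative in every class and subtract the row of the representative from
  the other rows of the class, adding the columns correspondingly. Rows outside the set \<open>S\<close> of
  representatives lose their blow-up part, since it is constant along a class, and a column in \<open>S\<close>
  collects the \<open>m\<close> equal entries of its class. With \<open>S\<close> listed first the result is block
  upper triangular: the quotient matrix on \<open>S\<close>, and below it the diagonal matrix with entries
  \<open>- d\<close> at the \<open>m - 1\<close> remaining elements of each class.\<close>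

lemma matrix_energy_blow_up:
  fixes h :: "'b \<Rightarrow> 'b \<Rightarrow> real" and d :: "'b \<Rightarrow> real"
  assumes V: "finite V" and \<tau>: "\<tau> ` V \<subseteq> W"
    and fibres: "\<And>w. w \<in> W \<Longrightarrow> card {x \<in> V. \<tau> x = w} = m" and m: "m > 0"
  shows "matrix_energy (indexed_mat V (\<lambda>x y. h (\<tau> x) (\<tau> y) - (if x = y then d (\<tau> x) else 0))) =
    (real m - 1) * (\<Sum>w\<in>W. \<bar>d w\<bar>) +
    matrix_energy (indexed_mat W (\<lambda>w w'. real m * h w w' - (if w = w' then d w else 0)))"
proof -
  have "\<exists>x. x \<in> V \<and> \<tau> x = w" if "w \<in> W" for w
    using fibres[OF that] m by (metis (mono_tags, lifting) Collect_empty_eq card.empty not_gr0)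
  then obtain s where s: "\<And>w. w \<in> W \<Longrightarrow> s w \<in> V" "\<And>w. w \<in> W \<Longrightarrow> \<tau> (s w) = w"
    by metis
  have W: "finite W"
    using s V by (metis finite_subset finite_imageI image_eqI subsetI)
  define S where "S = s ` W"
  define \<sigma> where "\<sigma> x = s (\<tau> x)" for x
  have inj: "inj_on s W"
    using s(2) by (metis inj_onI)
  have S: "S \<subseteq> V" "finite S"
    using s W by (auto simp: S_def)
  have \<sigma>: "\<sigma> x \<in> S" "\<sigma> x \<in> V" "\<tau> (\<sigma> x) = \<tau> x" if "x \<in> V" for x
    using that \<tau> s by (auto simp: S_def \<sigma>_def)
  have \<sigma>S: "\<sigma> x = x" if "x \<in> S" for x
    using that s by (auto simp: S_def \<sigma>_def)
  have \<sigma>_eq: "\<sigma> x = z \<longleftrightarrow> \<tau> x = \<tau> z" if "x \<in> V" "z \<in> S" for x z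
    using that \<sigma> \<sigma>S S by (metis \<sigma>_def)
  define a where "a x y = h (\<tau> x) (\<tau> y) - (if x = y then d (\<tau> x) else 0)" for x y
  define b where "b w w' = real m * h w w' - (if w = w' then d w else 0)" for w w'
  \<comment> \<open>The block triangular matrix that results from the base change.\<close>
  define t where "t x y =
    (if y \<in> S then if x \<in> S then b (\<tau> x) (\<tau> y) else 0
     else if x \<in> S then h (\<tau> x) (\<tau> y) else if x = y then - d (\<tau> x) else 0)" for x y
  \<comment> \<open>The summand with factor \<open>c\<close> has its nonzero entries in rows outside \<open>S\<close> and columns in \<open>S\<close>, so it
    squares to zero and \<open>P (- c)\<close> is inverse to \<open>P c\<close>.\<close>
  define P where "P c x y = of_bool (x = y) + c * of_bool (x \<notin> S \<and> y = \<sigma> x)" for c :: real and x y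
  have P_left: "(\<Sum>y\<in>V. P c x y * g y) = g x + (if x \<notin> S then c * g (\<sigma> x) else 0)"
    if "x \<in> V" for c x g
    unfolding P_def using sum_add_of_bool_mult[of V x "x \<notin> S" "\<sigma> x" c g] V that \<sigma>(2) by blast
  have inverse: "(\<Sum>y\<in>V. P c x y * P (- c) y z) = of_bool (x = z)" if "x \<in> V" "z \<in> V" for c x z
    using that \<sigma> by (subst P_left) (auto simp: P_def)
  have fibre_sum: "(\<Sum>y\<in>V. if \<tau> y = w then a x y else 0) =
      b (\<tau> x) w" if "x \<in> V" "w \<in> W" for x w
  proof -
    have "(\<Sum>y\<in>V. if \<tau> y = w then a x y else 0) =
        (\<Sum>y\<in>V. if \<tau> y = w then h (\<tau> x) w else 0) - (\<Sum>y\<in>V. if x = y then (if \<tau> x = w then d w else 0) else 0)"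
      unfolding sum_subtractf[symmetric] by (rule sum.cong) (auto simp: a_def)
    also have "(\<Sum>y\<in>V. if \<tau> y = w then h (\<tau> x) w else 0) = real m * h (\<tau> x) w"
      using fibres[OF that(2)] V by (simp add: sum.inter_filter[symmetric])
    also have "(\<Sum>y\<in>V. if x = y then (if \<tau> x = w then d w else 0) else 0) = (if \<tau> x = w then d w else 0)"
      using that V by simp
    finally show ?thesis
      by (auto simp: b_def)
  qed
  have intertwine: "(\<Sum>y\<in>V. a x y * P 1 y z) = (\<Sum>y\<in>V. P 1 x y * t y z)" if x: "x \<in> V" and z: "z \<in> V" for x z
  proof (cases "z \<in> S")
    case True
    have "P 1 y z = of_bool (\<tau> y = \<tau> z)" if "y \<in> V" for y
    proof (cases "y \<in> S")
      case True
      then have "y = z \<longleftrightarrow> \<tau> y = \<tau> z"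
        using \<sigma>_eq[OF that \<open>z \<in> S\<close>] \<sigma>S[of y] by simp
      with True show ?thesis
        by (simp add: P_def)
    next
      case False
      then have "y \<noteq> z"
        using True by blast
      moreover have "z = \<sigma> y \<longleftrightarrow> \<tau> y = \<tau> z"
        using \<sigma>_eq[OF that True] by blast
      ultimately show ?thesis
        using False by (simp add: P_def)
    qed
    then have "(\<Sum>y\<in>V. a x y * P 1 y z) = (\<Sum>y\<in>V. if \<tau> y = \<tau> z then a x y else 0)"
      by (intro sum.cong) auto
    also have "\<dots> = b (\<tau> x) (\<tau> z)"
      using fibre_sum x z \<tau> by auto
    also have "\<dots> = (\<Sum>y\<in>V. P 1 x y * t y z)"
      using x True \<sigma> by (simp add: P_left t_def)
    finally show ?thesis .
  next
    case False
    have "P 1 y z = of_bool (y = z)" if "y \<in> V" for y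
      using False \<sigma>(1)[OF that] by (auto simp: P_def simp del: of_bool_eq_iff)
    then have "(\<Sum>y\<in>V. a x y * P 1 y z) = (\<Sum>y\<in>V. if y = z then a x y else 0)"
      by (intro sum.cong) auto
    also have "\<dots> = a x z"
      using z V by simp
    also have "\<dots> = (\<Sum>y\<in>V. P 1 x y * t y z)"
      using x False \<sigma> by (auto simp: P_left t_def a_def)
    finally show ?thesis .
  qed
  define ws where "ws = enumeration W"
  define ss where "ss = map s ws"
  define rs where "rs = enumeration (V - S)"
  have ws: "distinct ws" "set ws = W"
    unfolding ws_def using enumeration[OF W] by auto
  have ss: "distinct ss" "set ss = S"
    using ws inj by (auto simp: ss_def S_def distinct_map)
  have rs: "distinct rs" "set rs = V - S"
    unfolding rs_def using enumeration[of "V - S"] V by auto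
  have similar: "similar_mat (indexed_mat V a) (list_mat (ss @ rs) (ss @ rs) t)"
    unfolding indexed_mat_eq_list_mat[OF V]
  proof (rule similar_list_mat)
    show "distinct (ss @ rs)" "set (ss @ rs) = V"
      using ss rs S by auto
    show "(\<Sum>y\<in>V. P 1 x y * P (- 1) y z) = of_bool (x = z)"
      and "(\<Sum>y\<in>V. P (- 1) x y * P 1 y z) = of_bool (x = z)" if "x \<in> V" "z \<in> V" for x z
      using inverse[OF that, of 1] inverse[OF that, of "- 1"] by simp_all
  qed (fact enumeration[OF V] intertwine)+
  have blocks: "list_mat (ss @ rs) (ss @ rs) t =
      four_block_mat (list_mat ss ss t) (list_mat ss rs t) (list_mat rs ss t) (list_mat rs rs t)"
    unfolding list_mat_def by (intro eq_matI) (auto simp: nth_append)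
  have lower_left: "list_mat rs ss t = 0\<^sub>m (length rs) (length ss)"
    unfolding list_mat_def using ss rs nth_mem by (intro eq_matI) (fastforce simp: t_def)+
  have lower_right: "list_mat rs rs t = list_mat rs rs (\<lambda>x y. if x = y then - d (\<tau> x) else 0)"
    using rs by (intro list_mat_cong) (auto simp: t_def)
  have upper_left: "list_mat ss ss t = indexed_mat W b"
  proof -
    have "list_mat ss ss t = list_mat ws ws (\<lambda>w w'. t (s w) (s w'))"
      unfolding list_mat_def ss_def by (intro eq_matI) auto
    also have "\<dots> = list_mat ws ws b"
      using ws s by (intro list_mat_cong) (auto simp: t_def S_def)
    finally show ?thesis
      by (simp add: indexed_mat_eq_list_mat[OF W] ws_def)
  qed
  have "matrix_energy (indexed_mat V a) =
      matrix_energy (list_mat ss ss t) + matrix_energy (list_mat rs rs t)"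
    unfolding matrix_energy_similar[OF similar] blocks lower_left
    by (rule matrix_energy_block_triangular) (rule list_mat_carrier)+
  also have "matrix_energy (list_mat rs rs t) = (\<Sum>x\<in>V - S. \<bar>- d (\<tau> x)\<bar>)"
    unfolding lower_right matrix_energy_diagonal[OF rs(1)] rs(2) ..
  finally have "matrix_energy (indexed_mat V a) =
      matrix_energy (indexed_mat W b) + (\<Sum>x\<in>V - S. \<bar>- d (\<tau> x)\<bar>)"
    unfolding upper_left .
  moreover have "(\<Sum>x\<in>V - S. \<bar>- d (\<tau> x)\<bar>) = (real m - 1) * (\<Sum>w\<in>W. \<bar>d w\<bar>)"
  proof -
    have "(\<Sum>x\<in>V. \<bar>d (\<tau> x)\<bar>) = (\<Sum>w\<in>W. \<Sum>x\<in>{x \<in> V. \<tau> x = w}. \<bar>d (\<tau> x)\<bar>)"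
      using sum.group[OF V W \<tau>, of "\<lambda>x. \<bar>d (\<tau> x)\<bar>"] by simp
    also have "\<dots> = real m * (\<Sum>w\<in>W. \<bar>d w\<bar>)"
      using fibres by (simp add: sum_distrib_left)
    finally have "(\<Sum>x\<in>V. \<bar>d (\<tau> x)\<bar>) = real m * (\<Sum>w\<in>W. \<bar>d w\<bar>)" .
    moreover have "(\<Sum>x\<in>S. \<bar>d (\<tau> x)\<bar>) = (\<Sum>w\<in>W. \<bar>d w\<bar>)"
      using s inj by (simp add: S_def sum.reindex)
    ultimately show ?thesis
      using V S by (simp add: sum_diff algebra_simps)
  qed
  ultimately show ?thesis
    by (simp add: a_def[abs_def] b_def[abs_def])
qed

section \<open>Lines in the plane over a prime field\<close>

locale prime_modulus =
  fixes q :: int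
  assumes prime_q: "prime q"
begin

text \<open>Its vanishing modulo \<open>q\<close> expresses that two vectors are proportional.\<close>

fun det2 :: "int \<times> int \<Rightarrow> int \<times> int \<Rightarrow> int" where
  "det2 (a, b) (c, d) = a * d - b * c"

text \<open>Vectors and matrices may have arbitrary integer entries; only their residues count. Hence being
  nonzero refers to residues, while \<open>line\<close> is a set of canonical representatives.\<close>

fun nonzero :: "int \<times> int \<Rightarrow> bool" where
  "nonzero (a, b) \<longleftrightarrow> \<not> (q dvd a \<and> q dvd b)"

fun line :: "int \<times> int \<Rightarrow> (int \<times> int) set" where
  "line (a, b) = {((c * a) mod q, (c * b) mod q) | c. c \<in> {0..<q}}"

abbreviation plane :: "(int \<times> int) set" where
  "plane \<equiv> {0..<q} \<times> {0..<q}"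

lemma q_pos: "q > 0" "q > 1"
  using prime_q prime_gt_0_int prime_gt_1_int by blast+

lemma prime_dvd_mult_q: "q dvd a * b \<longleftrightarrow> q dvd a \<or> q dvd b"
  using prime_q by (rule prime_dvd_mult_iff)

lemma inverse_mod:
  assumes "\<not> q dvd a"
  obtains i where "q dvd i * a - 1"
proof -
  have "coprime a q"
    using assms prime_q by (metis coprime_commute prime_imp_coprime)
  then obtain i where "[a * i = 1] (mod q)"
    using cong_solve_coprime_int by blast
  then show ?thesis
    using that[of i] by (simp add: cong_iff_dvd_diff mult.commute)
qed

text \<open>Congruences are derived by exhibiting a difference as an explicit combination of
  differences known to be divisible by \<open>q\<close>; the shape \<open>r * a + s * b\<close> is the one matched in those steps.\<close>

lemma dvd_linear_combination: "q dvd a \<Longrightarrow> q dvd b \<Longrightarrow> q dvd r * a + s * b" for a b r s :: int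
  by simp

lemma mod_eq_of_dvd: "q dvd a - z \<Longrightarrow> z \<in> {0..<q} \<Longrightarrow> a mod q = z"
  by (metis atLeastLessThan_iff mod_eq_dvd_iff mod_pos_pos_trivial)

lemma dvd_diff_mod: "q dvd a - a mod q"
  by (simp add: minus_mod_eq_mult_div)

lemma proportional:
  assumes "nonzero (a, b)" and d: "q dvd a * y - b * x"
  shows "\<exists>c. q dvd c * a - x \<and> q dvd c * b - y"
proof (cases "q dvd a")
  case False
  then obtain i where i: "q dvd i * a - 1"
    by (rule inverse_mod)
  have "i * x * a - x = x * (i * a - 1) + 0 * (i * a - 1)"
    "i * x * b - y = y * (i * a - 1) + (- i) * (a * y - b * x)"
    by (simp_all add: algebra_simps)
  then show ?thesis
    using i d by (metis dvd_linear_combination)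
next
  case True
  then have "\<not> q dvd b"
    using assms by simp
  then obtain i where i: "q dvd i * b - 1"
    by (rule inverse_mod)
  have "i * y * b - y = y * (i * b - 1) + 0 * (i * b - 1)"
    "i * y * a - x = x * (i * b - 1) + i * (a * y - b * x)"
    by (simp_all add: algebra_simps)
  then show ?thesis
    using i d by (metis dvd_linear_combination)
qed

lemma line_mem_iff:
  assumes "nonzero u"
  shows "z \<in> line u \<longleftrightarrow> z \<in> plane \<and> q dvd det2 u z"
proof -
  obtain a b where u: "u = (a, b)" by fastforce
  obtain x y where z: "z = (x, y)" by fastforce
  show ?thesis
  proof
    assume "z \<in> line u"
    then obtain c where c: "x = (c * a) mod q" "y = (c * b) mod q"
      by (auto simp: u z)
    have "a * y - b * x = b * (c * a - x) + (- a) * (c * b - y)"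
      by (simp add: algebra_simps)
    then have "q dvd a * y - b * x"
      using dvd_linear_combination dvd_diff_mod c by metis
    then show "z \<in> plane \<and> q dvd det2 u z"
      using c q_pos by (simp add: u z)
  next
    assume *: "z \<in> plane \<and> q dvd det2 u z"
    then have d: "q dvd a * y - b * x"
      by (simp add: u z)
    have "\<exists>c. q dvd c * a - x \<and> q dvd c * b - y"
      using proportional[OF assms[unfolded u] d] .
    then obtain c where c: "q dvd c * a - x" "q dvd c * b - y"
      by blast
    have "x = (c mod q * a) mod q" "y = (c mod q * b) mod q"
      using * mod_eq_of_dvd[OF c(1)] mod_eq_of_dvd[OF c(2)] by (auto simp: z mod_mult_left_eq)
    then show "z \<in> line u"
      using q_pos by (auto simp: u z intro!: exI[of _ "c mod q"])
  qed
qed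

lemma det2_trans:
  assumes "nonzero v" "q dvd det2 u v" "q dvd det2 v w"
  shows "q dvd det2 u w"
proof -
  obtain a b c d x y where eqs: "u = (a, b)" "v = (c, d)" "w = (x, y)"
    by (metis surj_pair)
  have "c * det2 u w = a * det2 v w + x * det2 u v" "d * det2 u w = b * det2 v w + y * det2 u v"
    unfolding eqs det2.simps by (simp_all add: algebra_simps)
  then have "q dvd c * det2 u w" "q dvd d * det2 u w"
    using assms(2,3) by (metis dvd_linear_combination)+
  then show ?thesis
    using assms(1) by (auto simp: eqs prime_dvd_mult_q)
qed

lemma det2_commute: "det2 u v = - det2 v u"
  by (cases u; cases v) simp

lemma dvd_det2_commute: "q dvd det2 u v \<longleftrightarrow> q dvd det2 v u"
  by (subst det2_commute) simp

text \<open>Lines are the classes of proportionality, which is transitive on nonzero vectors by \<open>det2_trans\<close>.\<close>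

lemma line_eq_iff:
  assumes "nonzero u" "nonzero v"
  shows "line u = line v \<longleftrightarrow> q dvd det2 u v"
proof
  assume eq: "line u = line v"
  obtain a b c d where eqs: "u = (a, b)" "v = (c, d)"
    by (metis surj_pair)
  have "(c mod q, d mod q) \<in> line v"
    using q_pos by (auto simp: eqs intro!: exI[of _ 1])
  then have "q dvd det2 u (c mod q, d mod q)"
    using line_mem_iff[OF assms(1)] by (simp add: eq[symmetric])
  moreover have "det2 u v = 1 * det2 u (c mod q, d mod q) + 1 * (a * (d - d mod q) - b * (c - c mod q))"
    unfolding eqs det2.simps by (simp add: algebra_simps)
  moreover have "q dvd a * (d - d mod q) - b * (c - c mod q)"
    by (intro dvd_diff dvd_mult dvd_diff_mod)
  ultimately show "q dvd det2 u v"
    by (metis dvd_linear_combination)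
next
  assume "q dvd det2 u v"
  then have "q dvd det2 u z \<longleftrightarrow> q dvd det2 v z" for z
    using assms det2_trans dvd_det2_commute by blast
  then show "line u = line v"
    using assms by (simp add: set_eq_iff line_mem_iff)
qed

definition all_lines :: "(int \<times> int) set set" where
  "all_lines = {line u | u. nonzero u}"

text \<open>Every line is vertical or is given by a unique slope, which makes it easy to count the lines.\<close>

lemma all_lines_eq: "all_lines = insert (line (0, 1)) ((\<lambda>t. line (1, t)) ` {0..<q})"
proof -
  have nz: "nonzero (0, 1)" "nonzero (1, t)" for t
    using q_pos by auto
  show ?thesis
  proof (intro equalityI subsetI)
    fix l
    assume "l \<in> all_lines"
    then obtain a b where l: "l = line (a, b)" "nonzero (a, b)"
      by (auto simp: all_lines_def)
    show "l \<in> insert (line (0, 1)) ((\<lambda>t. line (1, t)) ` {0..<q})"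
    proof (cases "q dvd a")
      case True
      then have "l = line (0, 1)"
        using l nz by (subst l(1)) (subst line_eq_iff, auto)
      then show ?thesis by simp
    next
      case False
      then obtain i where i: "q dvd i * a - 1"
        by (rule inverse_mod)
      define t where "t = (i * b) mod q"
      have "a * t - b * 1 = b * (i * a - 1) + (- a) * (i * b - t)"
        by (simp add: algebra_simps)
      then have "q dvd det2 (a, b) (1, t)"
        using i dvd_diff_mod[of "i * b"] by (metis det2.simps dvd_linear_combination t_def)
      then have "l = line (1, t)"
        using l nz line_eq_iff by blast
      moreover have "t \<in> {0..<q}"
        using q_pos by (simp add: t_def)
      ultimately show ?thesis by blast
    qed
  qed (use nz in \<open>auto simp: all_lines_def simp del: nonzero.simps line.simps\<close>)
qed

lemma card_all_lines: "card all_lines = nat q + 1"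
proof -
  have nz: "nonzero (0, 1)" "nonzero (1, t)" for t
    using q_pos by auto
  have "s = t" if "s \<in> {0..<q}" "t \<in> {0..<q}" "line (1, s) = line (1, t)" for s t
  proof -
    have "q dvd t - s"
      using that(3) nz by (simp add: line_eq_iff del: line.simps nonzero.simps)
    then show ?thesis
      using that(1,2) mod_eq_of_dvd by (metis atLeastLessThan_iff mod_pos_pos_trivial)
  qed
  then have "inj_on (\<lambda>t. line (1, t)) {0..<q}"
    by (auto intro!: inj_onI simp del: line.simps)
  moreover have "line (0, 1) \<notin> (\<lambda>t. line (1, t)) ` {0..<q}"
    using nz q_pos by (auto simp: line_eq_iff simp del: line.simps nonzero.simps)
  ultimately show ?thesis
    unfolding all_lines_eq by (simp add: card_image del: line.simps)
qed

subsection \<open>Matrices of rank one\<close>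

text \<open>A matrix is the tuple of its entries, read row by row.\<close>

type_synonym mat2 = "int \<times> int \<times> int \<times> int"

definition matrices :: "mat2 set" where
  "matrices = {0..<q} \<times> {0..<q} \<times> {0..<q} \<times> {0..<q}"

fun reduce :: "mat2 \<Rightarrow> mat2" where
  "reduce (a, b, c, d) = (a mod q, b mod q, c mod q, d mod q)"

fun matmul :: "mat2 \<Rightarrow> mat2 \<Rightarrow> mat2" where
  "matmul (a, b, c, d) (a', b', c', d') =
    (a * a' + b * c', a * b' + b * d', c * a' + d * c', c * b' + d * d')"

fun det :: "mat2 \<Rightarrow> int" where
  "det (a, b, c, d) = a * d - b * c"

fun scale :: "int \<Rightarrow> mat2 \<Rightarrow> mat2" where
  "scale r (a, b, c, d) = (r * a, r * b, r * c, r * d)"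

text \<open>The matrix of the map sending \<open>z\<close> to \<open>det2 v z\<close> times \<open>u\<close>. Parametrising by a vector \<open>v\<close>
  spanning the kernel, rather than by a linear form, makes kernel and image vectors directly comparable.\<close>

fun rank_one :: "int \<times> int \<Rightarrow> int \<times> int \<Rightarrow> mat2" where
  "rank_one (a, b) (c, d) = (- a * d, a * c, - b * d, b * c)"

fun kernel :: "mat2 \<Rightarrow> (int \<times> int) set" where
  "kernel (a, b, c, d) = {(x, y) \<in> plane. q dvd a * x + b * y \<and> q dvd c * x + d * y}"

fun range2 :: "mat2 \<Rightarrow> (int \<times> int) set" where
  "range2 (a, b, c, d) = (\<lambda>(x, y). ((a * x + b * y) mod q, (c * x + d * y) mod q)) ` plane"

lemma reduce_in: "reduce X \<in> matrices"
  using q_pos by (cases X) (simp add: matrices_def)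

lemma reduce_id: "X \<in> matrices \<Longrightarrow> reduce X = X"
  by (cases X) (simp add: matrices_def)

lemma finite_matrices: "finite matrices"
  by (simp add: matrices_def)

lemma reduce_eq_iff:
  "reduce (a, b, c, d) = reduce (a', b', c', d') \<longleftrightarrow>
    q dvd a - a' \<and> q dvd b - b' \<and> q dvd c - c' \<and> q dvd d - d'"
  by (simp add: mod_eq_dvd_iff)

lemma reduce_eq_0_iff:
  "reduce (a, b, c, d) = (0, 0, 0, 0) \<longleftrightarrow> q dvd a \<and> q dvd b \<and> q dvd c \<and> q dvd d"
  by auto

lemma reduce_scale_eq_0_iff:
  "reduce (scale r X) = (0, 0, 0, 0) \<longleftrightarrow> q dvd r \<or> reduce X = (0, 0, 0, 0)"
  by (cases X) (auto simp: prime_dvd_mult_q mod_eq_0_iff_dvd)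

lemma mod_linear: "((a mod q) * x + (b mod q) * y) mod q = (a * x + b * y) mod q"
  by (metis mod_add_eq mod_mult_left_eq)

lemma reduce_scale_mod: "reduce (scale (r mod q) X) = reduce (scale r X)"
  by (cases X) (simp add: mod_mult_left_eq)

lemma reduce_matmul: "reduce (matmul (reduce X) (reduce Y)) = reduce (matmul X Y)"
proof -
  have "((a mod q) * (x mod q) + (b mod q) * (y mod q)) mod q = (a * x + b * y) mod q" for a b x y
    by (metis mod_add_eq mod_mult_eq)
  then show ?thesis
    by (cases X; cases Y) simp
qed

lemma reduce_rank_one_nonzero:
  "nonzero u \<Longrightarrow> nonzero v \<Longrightarrow> reduce (rank_one u v) \<noteq> (0, 0, 0, 0)"
  by (cases u; cases v) (auto simp: prime_dvd_mult_q mod_eq_0_iff_dvd)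

text \<open>Composing \<open>z \<mapsto> det2 v' z u'\<close> with \<open>z \<mapsto> det2 v z u\<close> evaluates the form \<open>det2 v\<close> at \<open>u'\<close>. So for
  nonzero vectors the product vanishes modulo \<open>q\<close> exactly if \<open>v\<close> and \<open>u'\<close> are proportional.\<close>

lemma matmul_rank_one: "matmul (rank_one u v) (rank_one u' v') = scale (det2 v u') (rank_one u v')"
  by (cases u; cases v; cases u'; cases v') (simp add: algebra_simps)

lemma reduce_matmul_rank_one_eq_0_iff:
  assumes "nonzero u" "nonzero v" "nonzero u'" "nonzero v'"
  shows "reduce (matmul (rank_one u v) (rank_one u' v')) = (0, 0, 0, 0) \<longleftrightarrow> line v = line u'"
  unfolding matmul_rank_one reduce_scale_eq_0_iff line_eq_iff[OF assms(2,3)]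
  using reduce_rank_one_nonzero[OF assms(1,4)] by blast

lemma dvd_mod_lin: "q dvd (a mod q) * x + (b mod q) * y \<longleftrightarrow> q dvd a * x + b * y"
  by (simp add: dvd_eq_mod_eq_0 mod_linear)

lemma kernel_reduce: "kernel (reduce X) = kernel X"
  by (cases X) (simp add: dvd_mod_lin)

lemma range2_reduce: "range2 (reduce X) = range2 X"
  by (cases X) (simp add: mod_linear)

lemma kernel_rank_one:
  assumes "nonzero u" "nonzero v"
  shows "kernel (rank_one u v) = line v"
proof -
  obtain a b c d where eqs: "u = (a, b)" "v = (c, d)"
    by (metis surj_pair)
  have "q dvd - a * d * x + a * c * y \<and> q dvd - b * d * x + b * c * y \<longleftrightarrow> q dvd det2 v (x, y)" for x y
  proof -
    have "- a * d * x + a * c * y = a * det2 v (x, y)" "- b * d * x + b * c * y = b * det2 v (x, y)"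
      unfolding eqs det2.simps by (simp_all add: algebra_simps)
    then show ?thesis
      using assms(1) by (metis eqs(1) nonzero.simps prime_dvd_mult_q)
  qed
  then show ?thesis
    using line_mem_iff[OF assms(2)] by (auto simp: eqs simp del: line.simps nonzero.simps)
qed

text \<open>A nonzero linear form takes every value, so the image of \<open>rank_one u v\<close> is the whole line of \<open>u\<close>.\<close>

lemma det2_surj:
  assumes "nonzero v"
  obtains x y where "(x, y) \<in> plane" "q dvd det2 v (x, y) - r"
proof -
  obtain c d where v: "v = (c, d)" by fastforce
  have "\<exists>x y. q dvd det2 v (x, y) - r"
  proof (cases "q dvd c")
    case False
    then obtain i where "q dvd i * c - 1"
      by (rule inverse_mod)
    moreover have "det2 v (0, i * r) - r = r * (i * c - 1)"
      unfolding v det2.simps by (simp add: algebra_simps)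
    ultimately show ?thesis
      by (metis dvd_mult)
  next
    case True
    then have "\<not> q dvd d"
      using assms by (simp add: v)
    then obtain i where "q dvd i * d - 1"
      by (rule inverse_mod)
    moreover have "det2 v (- i * r, 0) - r = r * (i * d - 1)"
      unfolding v det2.simps by (simp add: algebra_simps)
    ultimately show ?thesis
      by (metis dvd_mult)
  qed
  then obtain x y where xy: "q dvd det2 v (x, y) - r"
    by blast
  have "det2 v (x mod q, y mod q) - r =
      1 * (det2 v (x, y) - r) + 1 * (d * (x - x mod q) - c * (y - y mod q))"
    unfolding v det2.simps by (simp add: algebra_simps)
  moreover have "q dvd d * (x - x mod q) - c * (y - y mod q)"
    by (intro dvd_diff dvd_mult dvd_diff_mod)
  ultimately have "q dvd det2 v (x mod q, y mod q) - r"
    using xy by (metis dvd_linear_combination)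
  moreover have "(x mod q, y mod q) \<in> plane"
    using q_pos by simp
  ultimately show ?thesis
    by (rule that[rotated])
qed

lemma range2_rank_one:
  assumes "nonzero u" "nonzero v"
  shows "range2 (rank_one u v) = line u"
proof -
  obtain a b c d where eqs: "u = (a, b)" "v = (c, d)"
    by (metis surj_pair)
  have val: "- a * d * x + a * c * y = det2 v (x, y) * a" "- b * d * x + b * c * y = det2 v (x, y) * b" for x y
    unfolding eqs det2.simps by (simp_all add: algebra_simps)
  have range: "range2 (rank_one u v) =
      {((r * a) mod q, (r * b) mod q) | r. r \<in> det2 v ` plane}"
    unfolding eqs rank_one.simps range2.simps val[unfolded eqs] by (auto simp: image_iff)
  show ?thesis
  proof (intro equalityI subsetI)
    fix z
    assume "z \<in> range2 (rank_one u v)"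
    then obtain r where "z = ((r * a) mod q, (r * b) mod q)"
      unfolding range by blast
    then have "z = (((r mod q) * a) mod q, ((r mod q) * b) mod q)" "r mod q \<in> {0..<q}"
      using q_pos by (simp_all add: mod_mult_left_eq)
    then show "z \<in> line u"
      unfolding eqs line.simps by blast
  next
    fix z
    assume "z \<in> line u"
    then obtain r where z: "z = ((r * a) mod q, (r * b) mod q)"
      by (auto simp: eqs)
    obtain x y where xy: "(x, y) \<in> plane" "q dvd det2 v (x, y) - r"
      using det2_surj[OF assms(2)] .
    then have "det2 v (x, y) mod q = r mod q"
      by (simp add: mod_eq_dvd_iff)
    then have "z = ((det2 v (x, y) * a) mod q, (det2 v (x, y) * b) mod q)"
      unfolding z by (metis mod_mult_left_eq)
    then show "z \<in> range2 (rank_one u v)"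
      using xy(1) unfolding range by blast
  qed
qed

text \<open>If the first row is nonzero, a vanishing determinant makes the second row a multiple of it;
  otherwise only the second row matters. In both cases \<open>v\<close> is the row turned by a right angle.\<close>

lemma singular_rank_one:
  assumes "q dvd det X" "reduce X \<noteq> (0, 0, 0, 0)"
  obtains u v where "nonzero u" "nonzero v" "reduce X = reduce (rank_one u v)"
proof -
  obtain a b c d where X: "X = (a, b, c, d)"
    by (metis surj_pair)
  have "\<exists>u v. reduce X = reduce (rank_one u v)"
  proof (cases "nonzero (a, b)")
    case True
    then obtain r where "q dvd r * a - c" "q dvd r * b - d"
      using proportional assms(1) unfolding X det.simps by blast
    then have "reduce X = reduce (rank_one (1, r) (b, - a))"
      unfolding X rank_one.simps reduce_eq_iff by (simp add: dvd_diff_commute)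
    then show ?thesis
      by blast
  next
    case False
    then have "reduce X = reduce (rank_one (0, 1) (d, - c))"
      unfolding X rank_one.simps reduce_eq_iff by simp
    then show ?thesis
      by blast
  qed
  then obtain u v where uv: "reduce X = reduce (rank_one u v)"
    by blast
  then have "nonzero u" "nonzero v"
    using assms(2) by (cases u; cases v; auto)+
  with uv show ?thesis
    using that by blast
qed

text \<open>Multiplying \<open>X Y = 0\<close> by the adjugate of \<open>X\<close> shows that \<open>det X\<close> annihilates \<open>Y\<close>.\<close>

lemma zero_product_singular:
  assumes "reduce (matmul X Y) = (0, 0, 0, 0)" "reduce Y \<noteq> (0, 0, 0, 0)"
  shows "q dvd det X"
proof -
  obtain a b c d where X: "X = (a, b, c, d)"
    by (metis surj_pair)
  obtain a' b' c' d' where Y: "Y = (a', b', c', d')"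
    by (metis surj_pair)
  have z: "q dvd a * a' + b * c'" "q dvd a * b' + b * d'" "q dvd c * a' + d * c'" "q dvd c * b' + d * d'"
    using assms(1) by (auto simp: X Y)
  have "det X * a' = d * (a * a' + b * c') + (- b) * (c * a' + d * c')"
    "det X * b' = d * (a * b' + b * d') + (- b) * (c * b' + d * d')"
    "det X * c' = a * (c * a' + d * c') + (- c) * (a * a' + b * c')"
    "det X * d' = a * (c * b' + d * d') + (- c) * (a * b' + b * d')"
    unfolding X det.simps by (simp_all add: algebra_simps)
  then have "q dvd det X * a'" "q dvd det X * b'" "q dvd det X * c'" "q dvd det X * d'"
    using z by (metis dvd_linear_combination)+
  then show ?thesis
    using assms(2) by (auto simp: Y prime_dvd_mult_q simp del: det.simps)
qed

text \<open>The other order of the factors follows by transposition.\<close>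

lemma zero_product_singular':
  assumes "reduce (matmul Y X) = (0, 0, 0, 0)" "reduce Y \<noteq> (0, 0, 0, 0)"
  shows "q dvd det X"
proof -
  obtain a b c d where X: "X = (a, b, c, d)"
    by (metis surj_pair)
  obtain a' b' c' d' where Y: "Y = (a', b', c', d')"
    by (metis surj_pair)
  have "reduce (matmul (a, c, b, d) (a', c', b', d')) = (0, 0, 0, 0)"
    "reduce (a', c', b', d') \<noteq> (0, 0, 0, 0)"
    using assms by (auto simp: X Y mult.commute)
  then have "q dvd det (a, c, b, d)"
    by (rule zero_product_singular)
  then show ?thesis
    by (simp add: X mult.commute)
qed

lemma line_multiple:
  assumes "nonzero (a, b)" "nonzero (a', b')" "line (a', b') = line (a, b)"
  obtains r where "q dvd a' - r * a" "q dvd b' - r * b"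
proof -
  have "q dvd a * b' - b * a'"
    using line_eq_iff[OF assms(1,2)] assms(3)[symmetric] unfolding det2.simps by blast
  then obtain r where "q dvd r * a - a'" "q dvd r * b - b'"
    using proportional[OF assms(1)] by blast
  then have "q dvd a' - r * a" "q dvd b' - r * b"
    using dvd_diff_commute by blast+
  then show ?thesis
    by (rule that)
qed

definition matrices_of :: "(int \<times> int) set \<Rightarrow> (int \<times> int) set \<Rightarrow> mat2 set" where
  "matrices_of L M = {X \<in> matrices.
    (\<exists>u v. nonzero u \<and> nonzero v \<and> X = reduce (rank_one u v)) \<and> range2 X = L \<and> kernel X = M}"

text \<open>Replacing \<open>u\<close> and \<open>v\<close> by the multiples \<open>r u\<close> and \<open>s v\<close> multiplies the rank one matrix by \<open>r s\<close>.\<close>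

lemma matrices_of_eq:
  assumes u: "nonzero u" and v: "nonzero v"
  shows "matrices_of (line u) (line v) = (\<lambda>r. reduce (scale r (rank_one u v))) ` {1..<q}"
proof (intro equalityI subsetI)
  fix X
  assume "X \<in> matrices_of (line u) (line v)"
  then obtain u' v' where nz: "nonzero u'" "nonzero v'" and X: "X = reduce (rank_one u' v')"
    and "range2 X = line u" "kernel X = line v"
    unfolding matrices_of_def by blast
  then have lines: "line u' = line u" "line v' = line v"
    by (simp_all add: range2_reduce kernel_reduce range2_rank_one kernel_rank_one)
  obtain a b c d where eqs: "u = (a, b)" "v = (c, d)"
    by (metis surj_pair)
  obtain a' b' c' d' where eqs': "u' = (a', b')" "v' = (c', d')"
    by (metis surj_pair)
  obtain r where r: "q dvd a' - r * a" "q dvd b' - r * b"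
    using line_multiple u nz(1) lines(1) unfolding eqs eqs' by blast
  obtain s where s: "q dvd c' - s * c" "q dvd d' - s * d"
    using line_multiple v nz(2) lines(2) unfolding eqs eqs' by blast
  have "- a' * d' - r * s * (- a * d) = (- d') * (a' - r * a) + (- r * a) * (d' - s * d)"
    "a' * c' - r * s * (a * c) = c' * (a' - r * a) + (r * a) * (c' - s * c)"
    "- b' * d' - r * s * (- b * d) = (- d') * (b' - r * b) + (- r * b) * (d' - s * d)"
    "b' * c' - r * s * (b * c) = c' * (b' - r * b) + (r * b) * (c' - s * c)"
    by (simp_all add: algebra_simps)
  then have "X = reduce (scale (r * s) (rank_one u v))"
    unfolding X eqs eqs' rank_one.simps scale.simps reduce_eq_iff
    using r s by (metis dvd_linear_combination)
  then have X': "X = reduce (scale ((r * s) mod q) (rank_one u v))"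
    by (simp add: reduce_scale_mod)
  have "(r * s) mod q \<noteq> 0"
    using X' X reduce_rank_one_nonzero[OF nz] by (auto simp: eqs)
  moreover have "0 \<le> (r * s) mod q" "(r * s) mod q < q"
    using q_pos by simp_all
  ultimately have "(r * s) mod q \<in> {1..<q}"
    by simp
  with X' show "X \<in> (\<lambda>r. reduce (scale r (rank_one u v))) ` {1..<q}"
    by blast
next
  fix X
  assume "X \<in> (\<lambda>r. reduce (scale r (rank_one u v))) ` {1..<q}"
  then obtain r where r: "r \<in> {1..<q}" and X: "X = reduce (scale r (rank_one u v))"
    by blast
  obtain a b c d where eqs: "u = (a, b)" "v = (c, d)"
    by (metis surj_pair)
  define u' where "u' = (r * a, r * b)"
  have X': "X = reduce (rank_one u' v)"
    by (simp add: X u'_def eqs mult.assoc)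
  have "\<not> q dvd r"
    using r zdvd_not_zless by auto
  then have u': "nonzero u'"
    using u by (simp add: u'_def eqs prime_dvd_mult_q)
  have "line u' = line u"
    unfolding line_eq_iff[OF u' u] by (simp add: u'_def eqs)
  then have "range2 X = line u" "kernel X = line v"
    unfolding X' range2_reduce kernel_reduce range2_rank_one[OF u' v] kernel_rank_one[OF u' v]
    by simp_all
  moreover have "X \<in> matrices"
    unfolding X' by (rule reduce_in)
  ultimately show "X \<in> matrices_of (line u) (line v)"
    unfolding matrices_of_def using u' v X' by blast
qed

lemma card_matrices_of:
  assumes "L \<in> all_lines" "M \<in> all_lines"
  shows "card (matrices_of L M) = nat q - 1"
proof -
  obtain u v where uv: "nonzero u" "nonzero v" "L = line u" "M = line v"
    using assms by (auto simp: all_lines_def simp del: line.simps nonzero.simps)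
  have "inj_on (\<lambda>r. reduce (scale r (rank_one u v))) {1..<q}"
  proof (rule inj_onI)
    fix r s
    assume rs: "r \<in> {1..<q}" "s \<in> {1..<q}"
      and eq: "reduce (scale r (rank_one u v)) = reduce (scale s (rank_one u v))"
    obtain a b c d where X: "rank_one u v = (a, b, c, d)"
      by (metis surj_pair)
    have "reduce (scale (r - s) (rank_one u v)) = (0, 0, 0, 0)"
      using eq unfolding X scale.simps reduce_eq_iff reduce_eq_0_iff by (simp add: left_diff_distrib)
    then have "q dvd r - s"
      using reduce_rank_one_nonzero uv by (simp add: reduce_scale_eq_0_iff)
    then show "r = s"
      using rs mod_eq_of_dvd[of r s] by simp
  qed
  then show ?thesis
    unfolding uv matrices_of_eq[OF uv(1,2)] using q_pos by (simp add: card_image nat_diff_distrib)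
qed

end

section \<open>Quaternions modulo an odd prime as matrices\<close>

text \<open>The squares take \<open>(q + 1) div 2\<close> values modulo \<open>q\<close>, and so do the numbers \<open>- 1 - y\<^sup>2\<close>.
  These are together more than \<open>q\<close> values, so the two sets meet.\<close>

lemma minus_one_sum_two_squares_mod_prime:
  fixes q :: int
  assumes "prime q" "odd q"
  obtains x y :: int where "q dvd x\<^sup>2 + y\<^sup>2 + 1"
proof -
  define k where "k = (q - 1) div 2"
  have q: "q = 2 * k + 1" "k > 0"
    using assms prime_gt_1_int[of q] by (auto simp: k_def elim!: oddE)
  have sq: "x = y" if "x \<in> {0..k}" "y \<in> {0..k}" "q dvd x\<^sup>2 - y\<^sup>2" for x y
  proof -
    have "q dvd (x - y) * (x + y)"
      using that(3) by (simp add: power2_eq_square algebra_simps)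
    then have "q dvd x - y \<or> q dvd x + y"
      using assms(1) by (simp add: prime_dvd_mult_iff)
    then show ?thesis
    proof
      assume "q dvd x - y"
      then show ?thesis
        using that(1,2) q zdvd_imp_le[of q "\<bar>x - y\<bar>"] by (cases "x = y") auto
    next
      assume "q dvd x + y"
      then show ?thesis
        using that(1,2) q zdvd_imp_le[of q "x + y"] by (cases "x + y = 0") auto
    qed
  qed
  define A where "A = (\<lambda>x. x\<^sup>2 mod q) ` {0..k}"
  define B where "B = (\<lambda>y. (- 1 - y\<^sup>2) mod q) ` {0..k}"
  have "card A = nat (k + 1)" "card B = nat (k + 1)"
    unfolding A_def B_def using sq by (auto simp: card_image inj_on_def mod_eq_dvd_iff dvd_diff_commute)
  moreover have sub: "A \<union> B \<subseteq> {0..<q}"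
    using prime_gt_0_int[OF assms(1)] by (auto simp: A_def B_def)
  then have "card (A \<union> B) \<le> nat q"
    using card_mono[OF _ sub] by simp
  ultimately have "A \<inter> B \<noteq> {}"
    using card_Un_disjoint[of A B] q by (auto simp: A_def B_def)
  then obtain x y where "x\<^sup>2 mod q = (- 1 - y\<^sup>2) mod q"
    by (auto simp: A_def B_def)
  then have "q dvd x\<^sup>2 + y\<^sup>2 + 1"
    by (simp add: mod_eq_dvd_iff algebra_simps)
  then show ?thesis
    using that by blast
qed

lemma lipschitz_simps:
  assumes "n > 1"
  shows "carrier (lipschitz n) = {0..<int n} \<times> {0..<int n} \<times> {0..<int n} \<times> {0..<int n}"
    and "\<zero>\<^bsub>lipschitz n\<^esub> = (0, 0, 0, 0)"
    and "(a, b, c, d) \<otimes>\<^bsub>lipschitz n\<^esub> (a', b', c', d') =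
      ((a * a' - b * b' - c * c' - d * d') mod int n,
       (a * b' + b * a' + c * d' - d * c') mod int n,
       (a * c' - b * d' + c * a' + d * b') mod int n,
       (a * d' + b * c' - c * b' + d * a') mod int n)"
proof -
  interpret residues "int n" "residue_ring (int n)"
    using assms by unfold_locales auto
  show "carrier (lipschitz n) = {0..<int n} \<times> {0..<int n} \<times> {0..<int n} \<times> {0..<int n}"
    by (auto simp: lipschitz_def quaternion_ring_def res_carrier_eq)
  show "\<zero>\<^bsub>lipschitz n\<^esub> = (0, 0, 0, 0)"
    by (simp add: lipschitz_def quaternion_ring_def res_zero_eq)
  show "(a, b, c, d) \<otimes>\<^bsub>lipschitz n\<^esub> (a', b', c', d') =
      ((a * a' - b * b' - c * c' - d * d') mod int n,
       (a * b' + b * a' + c * d' - d * c') mod int n,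
       (a * c' - b * d' + c * a' + d * b') mod int n,
       (a * d' + b * c' - c * b' + d * a') mod int n)"
    by (simp add: lipschitz_def quaternion_ring_def a_minus_def res_add_eq res_mult_eq res_neg_eq mod_simps)
qed

locale odd_prime_split = prime_modulus "int p" for p :: nat +
  fixes \<alpha> \<beta> :: int
  assumes odd_p: "odd p" and minus_one: "int p dvd \<alpha>\<^sup>2 + \<beta>\<^sup>2 + 1"
begin

text \<open>Sends \<open>i\<close> to the matrix with rows \<open>(\<alpha>, \<beta>)\<close> and \<open>(\<beta>, - \<alpha>)\<close>, whose square is \<open>\<alpha>\<^sup>2 + \<beta>\<^sup>2\<close>,
  hence \<open>- 1\<close> modulo \<open>p\<close>, and \<open>j\<close> to the rotation with rows \<open>(0, - 1)\<close> and \<open>(1, 0)\<close>. These two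
  anticommute, and \<open>k\<close> goes to their product. The entries are reduced modulo \<open>p\<close> only by \<open>reduce\<close>.\<close>

fun quat_mat :: "mat2 \<Rightarrow> mat2" where
  "quat_mat (a, b, c, d) =
    (a + \<alpha> * b + \<beta> * d, \<beta> * b - c - \<alpha> * d, \<beta> * b + c - \<alpha> * d, a - \<alpha> * b - \<beta> * d)"

abbreviation L where "L \<equiv> lipschitz p"

lemma p_gt_1: "p > 1"
  using q_pos by simp

lemmas L_simps = lipschitz_simps[OF p_gt_1]

lemma quat_mat_reduce: "reduce (quat_mat (reduce x)) = reduce (quat_mat x)"
proof (cases x)
  case (fields a b c d)
  show ?thesis
    unfolding fields reduce.simps quat_mat.simps prod.inject cong_def[symmetric]
    by (intro conjI cong_add cong_diff cong_mult) simp_all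
qed

lemma quat_mat_mult:
  "reduce (quat_mat (x \<otimes>\<^bsub>L\<^esub> y)) = reduce (matmul (quat_mat x) (quat_mat y))"
proof -
  obtain a b c d where x: "x = (a, b, c, d)"
    by (metis surj_pair)
  obtain a' b' c' d' where y: "y = (a', b', c', d')"
    by (metis surj_pair)
  define a'' where "a'' = a * a' - b * b' - c * c' - d * d'"
  define b'' where "b'' = a * b' + b * a' + c * d' - d * c'"
  define c'' where "c'' = a * c' - b * d' + c * a' + d * b'"
  define d'' where "d'' = a * d' + b * c' - c * b' + d * a'"
  note defs = a''_def b''_def c''_def d''_def
  have "reduce (quat_mat (x \<otimes>\<^bsub>L\<^esub> y)) = reduce (quat_mat (a'', b'', c'', d''))"
    unfolding x y L_simps defs[symmetric] reduce.simps[symmetric] quat_mat_reduce ..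
  also have "\<dots> = reduce (matmul (quat_mat x) (quat_mat y))"
  proof -
    have "a'' + \<alpha> * b'' + \<beta> * d'' -
        ((a + \<alpha> * b + \<beta> * d) * (a' + \<alpha> * b' + \<beta> * d') + (\<beta> * b - c - \<alpha> * d) * (\<beta> * b' + c' - \<alpha> * d'))
        = (\<alpha>\<^sup>2 + \<beta>\<^sup>2 + 1) * (- b * b' - d * d')"
      "\<beta> * b'' - c'' - \<alpha> * d'' -
        ((a + \<alpha> * b + \<beta> * d) * (\<beta> * b' - c' - \<alpha> * d') + (\<beta> * b - c - \<alpha> * d) * (a' - \<alpha> * b' - \<beta> * d'))
        = (\<alpha>\<^sup>2 + \<beta>\<^sup>2 + 1) * (b * d' - d * b')"
      "\<beta> * b'' + c'' - \<alpha> * d'' -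
        ((\<beta> * b + c - \<alpha> * d) * (a' + \<alpha> * b' + \<beta> * d') + (a - \<alpha> * b - \<beta> * d) * (\<beta> * b' + c' - \<alpha> * d'))
        = (\<alpha>\<^sup>2 + \<beta>\<^sup>2 + 1) * (d * b' - b * d')"
      "a'' - \<alpha> * b'' - \<beta> * d'' -
        ((\<beta> * b + c - \<alpha> * d) * (\<beta> * b' - c' - \<alpha> * d') + (a - \<alpha> * b - \<beta> * d) * (a' - \<alpha> * b' - \<beta> * d'))
        = (\<alpha>\<^sup>2 + \<beta>\<^sup>2 + 1) * (- b * b' - d * d')"
      unfolding defs by (simp_all add: algebra_simps power2_eq_square)
    then show ?thesis
      unfolding x y quat_mat.simps matmul.simps reduce_eq_iff using minus_one by (metis dvd_mult2)
  qed
  finally show ?thesis .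
qed

lemma dvd_two_mult: "int p dvd 2 * x \<Longrightarrow> int p dvd x"
proof -
  have "\<not> int p dvd 2"
    using odd_p p_gt_1 zdvd_imp_le[of "int p" 2] by (cases "p = 2") auto
  then show "int p dvd 2 * x \<Longrightarrow> int p dvd x"
    by (simp add: prime_dvd_mult_q)
qed

text \<open>Sums and differences of the matrix entries give \<open>2 a\<close>, \<open>2 c\<close>, \<open>2 (\<alpha> b + \<beta> d)\<close> and
  \<open>2 (\<beta> b - \<alpha> d)\<close>. As \<open>p\<close> is odd the factors \<open>2\<close> cancel, and \<open>b\<close>, \<open>d\<close> are recovered from the last
  two because the determinant of that system is \<open>- (\<alpha>\<^sup>2 + \<beta>\<^sup>2)\<close>, which is \<open>1\<close> modulo \<open>p\<close>.\<close>

lemma quat_mat_eq_0: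
  assumes "reduce (quat_mat x) = (0, 0, 0, 0)"
  shows "reduce x = (0, 0, 0, 0)"
proof -
  obtain a b c d where x: "x = (a, b, c, d)"
    by (metis surj_pair)
  have z: "int p dvd a + \<alpha> * b + \<beta> * d" "int p dvd \<beta> * b - c - \<alpha> * d"
    "int p dvd \<beta> * b + c - \<alpha> * d" "int p dvd a - \<alpha> * b - \<beta> * d"
    using assms unfolding x quat_mat.simps reduce_eq_0_iff by auto
  have "2 * a = 1 * (a + \<alpha> * b + \<beta> * d) + 1 * (a - \<alpha> * b - \<beta> * d)"
    "2 * c = (- 1) * (\<beta> * b - c - \<alpha> * d) + 1 * (\<beta> * b + c - \<alpha> * d)"
    "2 * (\<alpha> * b + \<beta> * d) = 1 * (a + \<alpha> * b + \<beta> * d) + (- 1) * (a - \<alpha> * b - \<beta> * d)"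
    "2 * (\<beta> * b - \<alpha> * d) = 1 * (\<beta> * b - c - \<alpha> * d) + 1 * (\<beta> * b + c - \<alpha> * d)"
    by simp_all
  then have "int p dvd 2 * a" "int p dvd 2 * c" "int p dvd 2 * (\<alpha> * b + \<beta> * d)" "int p dvd 2 * (\<beta> * b - \<alpha> * d)"
    using z by (metis dvd_linear_combination)+
  then have ac: "int p dvd a" "int p dvd c"
    and s: "int p dvd \<alpha> * b + \<beta> * d" and t: "int p dvd \<beta> * b - \<alpha> * d"
    using dvd_two_mult by blast+
  have "(\<alpha>\<^sup>2 + \<beta>\<^sup>2 + 1) * b - b = \<alpha> * (\<alpha> * b + \<beta> * d) + \<beta> * (\<beta> * b - \<alpha> * d)"
    "(\<alpha>\<^sup>2 + \<beta>\<^sup>2 + 1) * d - d = \<beta> * (\<alpha> * b + \<beta> * d) + (- \<alpha>) * (\<beta> * b - \<alpha> * d)"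
    by (simp_all add: algebra_simps power2_eq_square)
  then have "int p dvd (\<alpha>\<^sup>2 + \<beta>\<^sup>2 + 1) * b - b" "int p dvd (\<alpha>\<^sup>2 + \<beta>\<^sup>2 + 1) * d - d"
    using s t by (metis dvd_linear_combination)+
  then have "int p dvd b" "int p dvd d"
    using minus_one by (metis dvd_diff_right_iff dvd_mult2)+
  with ac show ?thesis
    by (simp add: x)
qed

text \<open>Quaternions and matrices modulo \<open>p\<close> are quadruples of residues, so injectivity of the map between them
  suffices.\<close>

lemma bij_quat_mat: "bij_betw (\<lambda>x. reduce (quat_mat x)) matrices matrices"
proof -
  have inj: "inj_on (\<lambda>x. reduce (quat_mat x)) matrices"
  proof (rule inj_onI)
    fix x y
    assume xy: "x \<in> matrices" "y \<in> matrices" "reduce (quat_mat x) = reduce (quat_mat y)"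
    obtain a b c d where x: "x = (a, b, c, d)"
      by (metis surj_pair)
    obtain a' b' c' d' where y: "y = (a', b', c', d')"
      by (metis surj_pair)
    have "reduce (quat_mat (a - a', b - b', c - c', d - d')) = (0, 0, 0, 0)"
      using xy(3) unfolding x y quat_mat.simps reduce_eq_iff reduce_eq_0_iff
      by (simp add: algebra_simps)
    then have "reduce (a - a', b - b', c - c', d - d') = (0, 0, 0, 0)"
      by (rule quat_mat_eq_0)
    then have "reduce x = reduce y"
      unfolding x y reduce_eq_iff reduce_eq_0_iff .
    then show "x = y"
      using xy(1,2) reduce_id by metis
  qed
  moreover have "(\<lambda>x. reduce (quat_mat x)) ` matrices = matrices"
    using reduce_in by (intro endo_inj_surj[OF finite_matrices _ inj]) blast
  ultimately show ?thesis
    by (simp add: bij_betw_def)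
qed

lemma quat_mat_0_iff:
  assumes "x \<in> matrices"
  shows "reduce (quat_mat x) = (0, 0, 0, 0) \<longleftrightarrow> x = (0, 0, 0, 0)"
proof
  assume "reduce (quat_mat x) = (0, 0, 0, 0)"
  then show "x = (0, 0, 0, 0)"
    using quat_mat_eq_0 reduce_id[OF assms] by metis
next
  assume "x = (0, 0, 0, 0)"
  then show "reduce (quat_mat x) = (0, 0, 0, 0)"
    by simp
qed

lemma L_carrier: "carrier L = matrices"
  by (simp add: L_simps matrices_def)

lemma L_mult_closed: "x \<otimes>\<^bsub>L\<^esub> y \<in> matrices"
proof -
  obtain a b c d a' b' c' d' where eqs: "x = (a, b, c, d)" "y = (a', b', c', d')"
    by (metis surj_pair)
  show ?thesis
    unfolding eqs L_simps(3) reduce.simps[symmetric] by (rule reduce_in)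
qed

lemma L_mult_eq_0_iff:
  "x \<otimes>\<^bsub>L\<^esub> y = (0, 0, 0, 0) \<longleftrightarrow> reduce (matmul (quat_mat x) (quat_mat y)) = (0, 0, 0, 0)"
  unfolding quat_mat_mult[symmetric] by (rule quat_mat_0_iff[OF L_mult_closed, symmetric])

definition rank_one_quats where
  "rank_one_quats = {x \<in> matrices. \<exists>u v. nonzero u \<and> nonzero v \<and> reduce (quat_mat x) = reduce (rank_one u v)}"

text \<open>A zero divisor is a singular matrix by the adjugate argument. Conversely, a matrix of rank one with
  kernel vector \<open>v\<close> is annihilated on the right by the nonzero matrix \<open>rank_one v v\<close>, whose image is spanned by \<open>v\<close>.\<close>

lemma zero_divisors_eq: "zero_divisors L = rank_one_quats"
proof (intro equalityI subsetI)
  fix x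
  assume "x \<in> zero_divisors L"
  then obtain y where x: "x \<in> matrices" "x \<noteq> (0, 0, 0, 0)" and y: "y \<in> matrices" "y \<noteq> (0, 0, 0, 0)"
    and xy: "x \<otimes>\<^bsub>L\<^esub> y = (0, 0, 0, 0) \<or> y \<otimes>\<^bsub>L\<^esub> x = (0, 0, 0, 0)"
    unfolding zero_divisors_def L_carrier L_simps(2) by blast
  have nz: "reduce (quat_mat x) \<noteq> (0, 0, 0, 0)" "reduce (quat_mat y) \<noteq> (0, 0, 0, 0)"
    using x y quat_mat_0_iff by blast+
  then have "int p dvd det (quat_mat x)"
    using xy zero_product_singular zero_product_singular' unfolding L_mult_eq_0_iff by blast
  then show "x \<in> rank_one_quats"
    using nz(1) x singular_rank_one unfolding rank_one_quats_def by blast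
next
  fix x
  assume "x \<in> rank_one_quats"
  then obtain u v where x: "x \<in> matrices" and uv: "nonzero u" "nonzero v"
    and eq: "reduce (quat_mat x) = reduce (rank_one u v)"
    unfolding rank_one_quats_def by blast
  obtain y where y: "y \<in> matrices" "reduce (quat_mat y) = reduce (rank_one v v)"
    using bij_quat_mat reduce_in unfolding bij_betw_def by (metis (no_types, lifting) imageE)
  have "reduce (matmul (quat_mat x) (quat_mat y)) = reduce (matmul (rank_one u v) (rank_one v v))"
    using eq y(2) by (metis reduce_matmul)
  then have "x \<otimes>\<^bsub>L\<^esub> y = (0, 0, 0, 0)"
    using reduce_matmul_rank_one_eq_0_iff uv by (simp add: L_mult_eq_0_iff)
  moreover have "x \<noteq> (0, 0, 0, 0)" "y \<noteq> (0, 0, 0, 0)"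
    using quat_mat_0_iff x y eq reduce_rank_one_nonzero uv by metis+
  ultimately show "x \<in> zero_divisors L"
    unfolding zero_divisors_def L_carrier L_simps(2) using x y(1) by blast
qed

text \<open>These pairs label the classes of the blow-up.\<close>

definition lines_of where
  "lines_of x = (range2 (quat_mat x), kernel (quat_mat x))"

lemma lines_of_rank_one:
  assumes "nonzero u" "nonzero v" "reduce (quat_mat x) = reduce (rank_one u v)"
  shows "lines_of x = (line u, line v)"
proof -
  have "lines_of x = (range2 (reduce (quat_mat x)), kernel (reduce (quat_mat x)))"
    unfolding lines_of_def range2_reduce kernel_reduce ..
  also have "\<dots> = (line u, line v)"
    unfolding assms(3) range2_reduce kernel_reduce range2_rank_one[OF assms(1,2)]
      kernel_rank_one[OF assms(1,2)] ..
  finally show ?thesis .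
qed

lemma lines_of_in: "lines_of ` zero_divisors L \<subseteq> all_lines \<times> all_lines"
proof (rule image_subsetI)
  fix x
  assume "x \<in> zero_divisors L"
  then obtain u v where uv: "nonzero u" "nonzero v" "reduce (quat_mat x) = reduce (rank_one u v)"
    unfolding zero_divisors_eq rank_one_quats_def by blast
  then show "lines_of x \<in> all_lines \<times> all_lines"
    unfolding lines_of_rank_one[OF uv] all_lines_def by blast
qed

lemma mult_eq_0_iff_lines:
  assumes "x \<in> zero_divisors L" "y \<in> zero_divisors L"
  shows "x \<otimes>\<^bsub>L\<^esub> y = \<zero>\<^bsub>L\<^esub> \<longleftrightarrow> snd (lines_of x) = fst (lines_of y)"
proof -
  obtain u v where x: "nonzero u" "nonzero v" "reduce (quat_mat x) = reduce (rank_one u v)"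
    using assms(1) unfolding zero_divisors_eq rank_one_quats_def by blast
  obtain u' v' where y: "nonzero u'" "nonzero v'" "reduce (quat_mat y) = reduce (rank_one u' v')"
    using assms(2) unfolding zero_divisors_eq rank_one_quats_def by blast
  have "reduce (matmul (quat_mat x) (quat_mat y)) = reduce (matmul (rank_one u v) (rank_one u' v'))"
    using x y by (metis reduce_matmul)
  then show ?thesis
    using x y reduce_matmul_rank_one_eq_0_iff
    by (simp add: L_simps(2) L_mult_eq_0_iff lines_of_rank_one[OF x] lines_of_rank_one[OF y])
qed

text \<open>The isomorphism with matrices identifies the class of \<open>(l, m)\<close> with \<open>matrices_of l m\<close>.\<close>

lemma card_fibre:
  assumes "w \<in> all_lines \<times> all_lines"
  shows "card {x \<in> zero_divisors L. lines_of x = w} = p - 1"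
proof -
  obtain l m where w: "w = (l, m)" "l \<in> all_lines" "m \<in> all_lines"
    using assms by blast
  let ?f = "\<lambda>x. reduce (quat_mat x)"
  have f: "inj_on ?f matrices" "?f ` matrices = matrices"
    using bij_quat_mat by (auto simp: bij_betw_def)
  let ?S = "{x \<in> zero_divisors L. lines_of x = w}"
  have S: "?S = {x \<in> matrices. ?f x \<in> matrices_of l m}"
    unfolding zero_divisors_eq rank_one_quats_def matrices_of_def lines_of_def w
    by (simp only: mem_Collect_eq conj_assoc prod.inject range2_reduce kernel_reduce reduce_in simp_thms)
  have "matrices_of l m \<subseteq> ?f ` matrices"
    unfolding f(2) matrices_of_def by blast
  then have image: "?f ` ?S = matrices_of l m"
    unfolding S by blast
  have "inj_on ?f ?S"
    using f(1) by (rule inj_on_subset) (use S in blast)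
  then have "card (?f ` ?S) = card ?S"
    by (rule card_image)
  then show ?thesis
    unfolding image card_matrices_of[OF w(2,3)] nat_int by (rule sym)
qed

lemma lines_eq: "lines p = all_lines"
proof -
  interpret residues "int p" "residue_ring (int p)"
    using p_gt_1 by unfold_locales auto
  have carrier: "carrier (residue_ring (int p)) = {0..<int p}"
    by (auto simp: res_carrier_eq)
  have line: "{(c \<otimes>\<^bsub>residue_ring (int p)\<^esub> u, c \<otimes>\<^bsub>residue_ring (int p)\<^esub> v) | c. c \<in> {0..<int p}} = line (u, v)" for u v
    by (simp add: res_mult_eq)
  have lines: "lines p = {line (u, v) | u v. u \<in> {0..<int p} \<and> v \<in> {0..<int p} \<and> (u, v) \<noteq> (0, 0)}"
    unfolding lines_def one_dim_subspaces_def carrier line res_zero_eq ..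
  show ?thesis
  proof (intro equalityI subsetI)
    fix l
    assume "l \<in> lines p"
    then obtain u v where uv: "l = line (u, v)" "u \<in> {0..<int p}" "v \<in> {0..<int p}" "(u, v) \<noteq> (0, 0)"
      unfolding lines by blast
    then have "nonzero (u, v)"
      using zdvd_not_zless[of u "int p"] zdvd_not_zless[of v "int p"] by auto
    with uv(1) show "l \<in> all_lines"
      unfolding all_lines_def by blast
  next
    fix l
    assume "l \<in> all_lines"
    then obtain u v where uv: "l = line (u, v)" "nonzero (u, v)"
      unfolding all_lines_def by force
    have "l = line (u mod int p, v mod int p)"
      unfolding uv(1) by (simp add: mod_mult_right_eq)
    moreover have "u mod int p \<in> {0..<int p}" "v mod int p \<in> {0..<int p}"
      using p_gt_1 by simp_all
    moreover have "(u mod int p, v mod int p) \<noteq> (0, 0)"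
      using uv(2) by auto
    ultimately show "l \<in> lines p"
      unfolding lines by blast
  qed
qed

end

section \<open>The energy of the zero divisor graph\<close>

theorem theorem7p2:
  fixes p :: nat
  assumes "prime p" and "odd p"
  shows "graph_energy (lipschitz_graph p) = (real p + 1) * (real p - 2) + matrix_energy (B_mat p)"
proof -
  have p: "prime (int p)" "odd (int p)"
    using assms by simp_all
  then obtain \<alpha> \<beta> where "int p dvd \<alpha>\<^sup>2 + \<beta>\<^sup>2 + 1"
    by (rule minus_one_sum_two_squares_mod_prime)
  then interpret odd_prime_split p \<alpha> \<beta>
    using assms(2) p(1) by unfold_locales
  \<comment> \<open>The blow-up data: \<open>h\<close> and \<open>d\<close> are the entries of \<open>H\<close> and of the diagonal of \<open>D\<close>.\<close>
  define h :: "(int \<times> int) set \<times> (int \<times> int) set \<Rightarrow> _ \<Rightarrow> real"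
    where "h = (\<lambda>(l, m) (l', m'). of_bool (m = l' \<or> m' = l))"
  define d :: "(int \<times> int) set \<times> (int \<times> int) set \<Rightarrow> real" where "d = (\<lambda>(l, m). of_bool (l = m))"
  have fin: "finite (zero_divisors L)" "finite all_lines"
    using card_all_lines finite_matrices by (auto simp: zero_divisors_def L_carrier intro: card_ge_0_finite)
  have pairs: "line_pairs p = all_lines \<times> all_lines"
    by (simp add: line_pairs_def lines_eq)
  have "adjacency_matrix (lipschitz_graph p) =
      indexed_mat (zero_divisors L) (\<lambda>x y. h (lines_of x) (lines_of y) - (if x = y then d (lines_of x) else 0))"
  proof -
    have adj: "(if (x, y) \<in> parcs (lipschitz_graph p) then 1 else 0) =
        h (lines_of x) (lines_of y) - (if x = y then d (lines_of x) else 0)"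
      if "x \<in> zero_divisors L" "y \<in> zero_divisors L" for x y
      using that mult_eq_0_iff_lines[OF that] mult_eq_0_iff_lines[OF that(2,1)]
      by (auto simp: lipschitz_graph_def zero_divisor_graph_def h_def d_def split: prod.splits)
    have "enumeration (zero_divisors L) ! i \<in> zero_divisors L" if "i < card (zero_divisors L)" for i
      using enumeration[OF fin(1)] that nth_mem by metis
    then show ?thesis
      unfolding adjacency_matrix_def indexed_mat_def using adj
      by (intro eq_matI) (auto simp: lipschitz_graph_def zero_divisor_graph_def)
  qed
  moreover have "B_mat p = indexed_mat (all_lines \<times> all_lines)
      (\<lambda>w w'. real (p - 1) * h w w' - (if w = w' then d w else 0))"
    unfolding B_mat_def H_mat_def D_mat_def indexed_mat_def pairs using p_gt_1
    by (intro eq_matI) (auto simp: h_def d_def of_nat_diff split: prod.splits)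
  moreover have "(\<Sum>w\<in>all_lines \<times> all_lines. \<bar>d w\<bar>) = real p + 1"
  proof -
    have "(\<Sum>w\<in>all_lines \<times> all_lines. \<bar>d w\<bar>) = (\<Sum>l\<in>all_lines. \<Sum>m\<in>all_lines. if l = m then 1 else 0)"
      unfolding sum.cartesian_product by (rule sum.cong) (auto simp: d_def)
    also have "\<dots> = real (card all_lines)"
      using fin(2) by simp
    finally show ?thesis
      by (simp add: card_all_lines)
  qed
  ultimately show ?thesis
    unfolding graph_energy_def
    using matrix_energy_blow_up[OF fin(1) lines_of_in card_fibre, of h d] p_gt_1
    by (simp add: of_nat_diff algebra_simps)
qed

end
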